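(* Let $\mathcal{F}\subseteq 2^{[n]}$ be a $(d,s,t)$-conditionally intersecting family, let $i,j\in[n]$, and let $\mathcal{A} = \{A_1,\ldots,A_d\}\subseteq\mathcal{F}$ be a subfamily of $d$ distinct sets that is $(i,j)$-unstable. Let $\mathcal{A}_{\bar{i}j}$, $\mathcal{A}_{i\bar{j}}$ and $\mathcal{A}_{\bar{i}\bar{j}}$ be the subfamilies of $\mathcal{A}$ defined in the context, suppose that $\mathcal{A}_{\bar{i}\bar{j}}\neq\emptyset$, and define \[ \mathcal{G} = \{A\in \mathcal{A}_{i\bar{j}} : S_{ji}(A) = A\},\qquad \mathcal{G}' = \{(A \setminus \{i\}) \cup \{j\} : A \in \mathcal{G}\}. \] Then $\mathcal{G} \neq \mathcal{A}_{i\bar{j}}$, and \[ \mathcal{B} = \mathcal{A}_{\bar{i}j}\cup \mathcal{A}_{\bar{i}\bar{j}}\cup (\mathcal{A}_{i\bar{j}} \setminus \mathcal{G}) \cup \mathcal{G}' \] is a $(j,i)$-unstable family of $d$ sets $\{B_1,\ldots,B_d\}\subseteq\mathcal{F}$. Conversely, with $\mathcal{B}_{\bar{j}i}$, $\mathcal{B}_{j\bar{i}}$ and $\mathcal{B}_{\bar{i}\bar{j}}$ the subfamilies of $\mathcal{B}$ defined in the context, \[ \mathcal{A} = \mathcal{B}_{\bar{j}i}\cup \mathcal{B}_{\bar{i}\bar{j}}\cup (\mathcal{B}_{j\bar{i}} \setminus \mathcal{H}) \cup \mathcal{H}', \] where \[ \mathcal{H} = \{B\in \mathcal{B}_{j\bar{i}}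 : S_{ij}(B) = B\},\qquad \mathcal{H}' = \{(B \setminus \{j\}) \cup \{i\} : B \in \mathcal{H}\}. \]
   Context: A family $\mathcal{F}\subseteq 2^{[n]}$, $[n]=\{1,\dots,n\}$, is $(d,s,t)$-conditionally intersecting if, for all distinct sets $A_1,\ldots,A_d\in\mathcal{F}$, $|A_1\cap\cdots\cap A_d|\geq t$ whenever $|A_1\cup\cdots\cup A_d|\leq s$. All shifts below are taken relative to the ambient family $\mathcal{F}$: for $a,b\in[n]$ and $A\in\mathcal{F}$, $S_{ab}(A) = A' := (A\setminus\{b\})\cup\{a\}$ if $b\in A$, $a\notin A$ and $A'\notin\mathcal{F}$, and $S_{ab}(A)=A$ otherwise. The parameters $d,s,t$ are fixed. A subfamily $\mathcal{A}=\{A_1,\dots,A_d\}$ of $d$ distinct sets of the $(d,s,t)$-conditionally intersecting family $\mathcal{F}$ is $(a,b)$-unstable if $\{S_{ab}(A_1),\ldots,S_{ab}(A_d)\}$ is not $(d,s,t)$-conditionally intersecting (while $\mathcal{A}$, being a subfamily of $\mathcal{F}$, is). For the $(i,j)$-unstable family $\mathcal{A}$ define $\mathcal{A}_{\bar{i}j} = \{A\in\mathcal{A} : j\in A,\ i\notin A,\ (A\setminus\{j\})\cup\{i\}\notin\mathcal{F}\}$ (equivalently $\{A\in\mathcal{A}: S_{ij}(A)\neq A\}$), $\mathcal{A}_{i\bar{j}} = \{A\in\mathcal{A} : j\notin A,\ i\in A\}$, and $\mathcal{A}_{\bar{i}\bar{j}} = \{A\in\mathcal{A} : j\notin A,\ i\notin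 A\}$. Analogously, with the roles of $i$ and $j$ exchanged, for $\mathcal{B}$ define $\mathcal{B}_{\bar{j}i} = \{B\in\mathcal{B} : i\in B,\ j\notin B,\ (B\setminus\{i\})\cup\{j\}\notin\mathcal{F}\}$, $\mathcal{B}_{j\bar{i}} = \{B\in\mathcal{B} : i\notin B,\ j\in B\}$, and $\mathcal{B}_{\bar{i}\bar{j}} = \{B\in\mathcal{B} : i\notin B,\ j\notin B\}$. *)

theory Defs
  imports Main
begin

text \<open>
  A collection of \<open>d\<close> distinct sets \<open>A\<^sub>1, \<dots>, A\<^sub>d\<close> is represented by the
  finite set \<open>\<A>\<close> with \<open>card \<A> = d\<close> that has them as elements. The explicit \<open>finite\<close> matters
  only for \<open>d = 0\<close>, as infinite sets have cardinality \<open>0\<close>.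
\<close>

definition cond_intersecting :: "nat \<Rightarrow> nat \<Rightarrow> nat \<Rightarrow> nat set set \<Rightarrow> bool" where
  "cond_intersecting d s t \<F> \<longleftrightarrow>
     (\<forall>\<A>. \<A> \<subseteq> \<F> \<and> finite \<A> \<and> card \<A> = d \<longrightarrow> card (\<Union>\<A>) \<le> s \<longrightarrow> card (\<Inter>\<A>) \<ge> t)"

definition shift :: "nat set set \<Rightarrow> nat \<Rightarrow> nat \<Rightarrow> nat set \<Rightarrow> nat set" where
  "shift \<F> a b A =
     (if b \<in> A \<and> a \<notin> A \<and> (A - {b}) \<union> {a} \<notin> \<F> then (A - {b}) \<union> {a} else A)"

definition unstable ::
  "nat \<Rightarrow> nat \<Rightarrow> nat \<Rightarrow> nat set set \<Rightarrow> nat \<Rightarrow> nat \<Rightarrow> nat set set \<Rightarrow> bool" where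
  "unstable d s t \<F> a b \<A> \<longleftrightarrow>
     \<A> \<subseteq> \<F> \<and> finite \<A> \<and> card \<A> = d \<and> \<not> cond_intersecting d s t (shift \<F> a b ` \<A>)"

text \<open>
  The next three functions, applied to \<open>i j \<A>\<close>, give the subfamilies of \<open>\<A>\<close> with indices
  \<open>(not i, j)\<close>, \<open>(i, not j)\<close> and \<open>(not i, not j)\<close>. The first one is not the plain trace
  condition: it also requires that the shifted set is not in \<open>\<F>\<close>, so that it consists of the
  members of \<open>\<A>\<close> that are moved by \<open>shift \<F> i j\<close>.
\<close>

definition moved_part :: "nat set set \<Rightarrow> nat \<Rightarrow> nat \<Rightarrow> nat set set \<Rightarrow> nat set set" where
  "moved_part \<F> i j \<A> = {A \<in> \<A>. j \<in> A \<and> i \<notin> A \<and> (A - {j}) \<union> {i} \<notin> \<F>}"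

definition only_part :: "nat \<Rightarrow> nat \<Rightarrow> nat set set \<Rightarrow> nat set set" where
  "only_part i j \<A> = {A \<in> \<A>. j \<notin> A \<and> i \<in> A}"

definition neither_part :: "nat \<Rightarrow> nat \<Rightarrow> nat set set \<Rightarrow> nat set set" where
  "neither_part i j \<A> = {A \<in> \<A>. j \<notin> A \<and> i \<notin> A}"

end

theory Submission
  imports Defs
begin

text \<open>
  Replacing \<open>j\<close> by \<open>i\<close> or conversely in some members of \<open>\<A>\<close> affects unions and intersections
  only in \<open>{i, j}\<close>, and a member that avoids both \<open>i\<close> and \<open>j\<close> makes the intersection invariant.
  Hence instability can come only from the union, which must lose \<open>j\<close>: both \<open>i\<close> and \<open>j\<close> lie in
  \<open>\<Union>\<A>\<close>, every member containing \<open>j\<close> is moved by the shift, and \<open>\<Union>\<A> - {i}\<close> has at most \<open>s\<close>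
  elements. Now \<open>\<B>\<close>, and also its shift by \<open>(j, i)\<close>, arises from \<open>\<A>\<close> by replacing \<open>i\<close> by \<open>j\<close>
  in some members; for \<open>\<B>\<close> not all members containing \<open>i\<close> can be replaced, since \<open>\<B> \<subseteq> \<F>\<close>, while
  for its shift all are.
\<close>

text \<open>A moved set lands outside \<open>\<F>\<close>, so it cannot meet a fixed one, and two
  moved sets are recovered from their images.\<close>

lemma inj_on_shift: "inj_on (shift \<F> a b) \<F>"
proof (rule inj_onI)
  fix A B assume "A \<in> \<F>" "B \<in> \<F>" and eq: "shift \<F> a b A = shift \<F> a b B"
  have "A = B" if "b \<in> A" "a \<notin> A" "b \<in> B" "a \<notin> B" "A - {b} \<union> {a} = B - {b} \<union> {a}"
    using that by blast
  then show "A = B"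
    using eq \<open>A \<in> \<F>\<close> \<open>B \<in> \<F>\<close> unfolding shift_def by (metis (lifting))
qed

text \<open>By injectivity the shifted family again has \<open>d\<close> members, so it is its own
  only subfamily of size \<open>d\<close>.\<close>

lemma unstable_iff:
  "unstable d s t \<F> a b \<A> \<longleftrightarrow> \<A> \<subseteq> \<F> \<and> finite \<A> \<and> card \<A> = d
     \<and> card (\<Union>(shift \<F> a b ` \<A>)) \<le> s \<and> card (\<Inter>(shift \<F> a b ` \<A>)) < t"
proof (cases "\<A> \<subseteq> \<F> \<and> finite \<A> \<and> card \<A> = d")
  case True
  then have fin: "finite (shift \<F> a b ` \<A>)" and card: "card (shift \<F> a b ` \<A>) = d"
    using inj_on_subset[OF inj_on_shift] by (auto simp: card_image)
  have "\<S> \<subseteq> shift \<F> a b ` \<A> \<and> finite \<S> \<and> card \<S> = d \<longleftrightarrow> \<S> = shift \<F> a b ` \<A>" for \<S>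
    using fin card card_subset_eq[OF fin] by auto
  then show ?thesis
    using True by (auto simp: unstable_def cond_intersecting_def not_le)
next
  case False
  then show ?thesis by (auto simp: unstable_def)
qed

lemma Union_image_Diff:
  assumes "\<And>A. A \<in> \<A> \<Longrightarrow> f A - X = A - X"
  shows "\<Union>(f ` \<A>) - X = \<Union>\<A> - X"
  using assms by blast

lemma Inter_image_eq:
  assumes "\<And>A. A \<in> \<A> \<Longrightarrow> f A - X = A - X"
    and "C \<in> \<A>" "f C = C" "C \<inter> X = {}"
  shows "\<Inter>(f ` \<A>) = \<Inter>\<A>"
proof (rule set_eqI)
  fix x
  show "x \<in> \<Inter>(f ` \<A>) \<longleftrightarrow> x \<in> \<Inter>\<A>"
  proof (cases "x \<in> X")
    case True
    then have "x \<notin> C" "x \<notin> f C" using assms by auto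
    then show ?thesis using \<open>C \<in> \<A>\<close> by blast
  next
    case False
    then have "x \<in> f A \<longleftrightarrow> x \<in> A" if "A \<in> \<A>" for A using assms(1)[OF that] by blast
    then show ?thesis by auto
  qed
qed

lemma shift_Diff: "shift \<F> a b A - {a, b} = A - {a, b}"
  by (auto simp: shift_def)

lemma unstable_structure:
  assumes fin: "finite (\<Union>\<F>)" and ci: "cond_intersecting d s t \<F>"
    and un: "unstable d s t \<F> i j \<A>" and C: "C \<in> neither_part i j \<A>"
  shows "\<And>A. A \<in> \<A> \<Longrightarrow> j \<in> A \<Longrightarrow> i \<notin> A \<and> A - {j} \<union> {i} \<notin> \<F>"
    and "i \<in> \<Union>\<A>" "j \<in> \<Union>\<A>" "card (\<Union>\<A> - {i}) \<le> s" "card (\<Inter>\<A>) < t"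
proof -
  define U where "U = \<Union>\<A>"
  define V where "V = \<Union>(shift \<F> i j ` \<A>)"
  have sub: "\<A> \<subseteq> \<F>" "finite \<A>" "card \<A> = d" and V: "card V \<le> s"
    and inter: "card (\<Inter>(shift \<F> i j ` \<A>)) < t"
    using un unfolding unstable_iff V_def by auto
  have C': "C \<in> \<A>" "i \<notin> C" "j \<notin> C" using C by (auto simp: neither_part_def)
  have "\<Inter>(shift \<F> i j ` \<A>) = \<Inter>\<A>"
    by (rule Inter_image_eq[OF shift_Diff C'(1)]) (use C' in \<open>auto simp: shift_def\<close>)
  then show t: "card (\<Inter>\<A>) < t" using inter by simp
  \<comment> \<open>Otherwise \<open>\<A>\<close> itself would violate the condition on
    \<open>\<F>\<close>.\<close>
  then have s: "s < card U"
    using ci sub unfolding cond_intersecting_def U_def by (metis not_le)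
  have finU: "finite U" using finite_subset[OF Union_mono fin] sub unfolding U_def by simp
  have UV: "V - {i, j} = U - {i, j}"
    unfolding U_def V_def by (rule Union_image_Diff) (rule shift_Diff)
  have finV: "finite V" by (rule finite_subset[of _ "U \<union> {i, j}"]) (use UV finU in auto)
  have not_sub: "\<not> U \<subseteq> V" using card_mono[OF finV, of U] V s by linarith
  \<comment> \<open>The shift never removes \<open>i\<close>, so the element of \<open>U\<close>
    missing from \<open>V\<close> can only be \<open>j\<close>.\<close>
  have "i \<in> V" if "i \<in> U" using that by (auto simp: U_def V_def shift_def)
  then have j: "j \<in> U" "j \<notin> V" using not_sub UV by auto
  then show "j \<in> \<Union>\<A>" by (simp add: U_def)
  show moved: "i \<notin> A \<and> A - {j} \<union> {i} \<notin> \<F>" if "A \<in> \<A>" "j \<in> A" for A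
  proof (rule ccontr)
    assume "\<not> ?thesis"
    then have "shift \<F> i j A = A" by (auto simp: shift_def)
    then have "j \<in> V" using that by (force simp: V_def)
    then show False using j by simp
  qed
  obtain A where A: "A \<in> \<A>" "j \<in> A" using j by (auto simp: U_def)
  then have "shift \<F> i j A = A - {j} \<union> {i}" using moved[OF A] by (simp add: shift_def)
  then have iV: "i \<in> V" using A(1) unfolding V_def by blast
  \<comment> \<open>If \<open>i\<close> were new in \<open>V\<close>, it would merely replace
    \<open>j\<close>, giving \<open>card U = card V \<le> s\<close>.\<close>
  show iU: "i \<in> \<Union>\<A>"
  proof (rule ccontr)
    assume "i \<notin> \<Union>\<A>"
    then have "U = insert j (V - {i})" using j UV iV by (auto simp: U_def)
    then have "card U = Suc (card (V - {i}))" using finV j by simp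
    also have "\<dots> = card V" by (rule card_Suc_Diff1[OF finV iV])
    finally show False using V s by simp
  qed
  have "U = insert j V" using j iV iU UV by (auto simp: U_def)
  then have "card U = Suc (card V)" using finV j by simp
  then have "card (U - {i}) = card V" using iU finU by (simp add: U_def)
  then show "card (\<Union>\<A> - {i}) \<le> s" using V by (simp add: U_def)
qed

theorem theorem12:
  fixes n d s t i j :: nat
    and \<F> \<A> \<G> \<G>' \<B> \<H> \<H>' :: "nat set set"
  assumes "\<F> \<subseteq> Pow {1..n}"
    and "cond_intersecting d s t \<F>"
    and "i \<in> {1..n}" and "j \<in> {1..n}"
    and "unstable d s t \<F> i j \<A>"
    and "neither_part i j \<A> \<noteq> {}"
    and "\<G> = {A \<in> only_part i j \<A>. shift \<F> j i A = A}"
    and "\<G>' = {(A - {i}) \<union> {j} | A. A \<in> \<G>}"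
    and "\<B> = moved_part \<F> i j \<A> \<union> neither_part i j \<A> \<union> (only_part i j \<A> - \<G>) \<union> \<G>'"
    and "\<H> = {B \<in> only_part j i \<B>. shift \<F> i j B = B}"
    and "\<H>' = {(B - {j}) \<union> {i} | B. B \<in> \<H>}"
  shows "\<G> \<noteq> only_part i j \<A>
    \<and> \<B> \<subseteq> \<F> \<and> card \<B> = d \<and> unstable d s t \<F> j i \<B>
    \<and> \<A> = moved_part \<F> j i \<B> \<union> neither_part i j \<B> \<union> (only_part j i \<B> - \<H>) \<union> \<H>'"
proof -
  define swap where "swap A = A - {i} \<union> {j}" for A
  \<comment> \<open>\<open>g\<close> carries \<open>\<A>\<close> to \<open>\<B>\<close>, and
    \<open>h\<close> carries it to the shift of \<open>\<B>\<close> by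
    \<open>(j, i)\<close>.\<close>
  define g where "g A = (if A \<in> \<G> then swap A else A)" for A
  define h where "h A = (if i \<in> A then swap A else A)" for A
  obtain C where C: "C \<in> neither_part i j \<A>" using assms(6) by blast
  then have C': "C \<in> \<A>" "i \<notin> C" "j \<notin> C" by (auto simp: neither_part_def)
  have finF: "finite (\<Union>\<F>)"
    by (rule finite_subset[of _ "{1..n}"]) (use assms(1) in auto)
  have sub: "\<A> \<subseteq> \<F>" "finite \<A>" "card \<A> = d" using assms(5) by (auto simp: unstable_def)
  note struct = unstable_structure[OF finF assms(2,5) C]
  have finU: "finite (\<Union>\<A>)" using finite_subset[OF Union_mono finF] sub by simp

  \<comment> \<open>Stated for any \<open>f\<close> agreeing with \<open>h\<close> on
    \<open>\<A>\<close>: it serves for \<open>g\<close>, under the assumption to be refuted that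
    \<open>\<G>\<close> is the whole part, and for \<open>shift \<F> j i \<circ> g\<close>.\<close>
  have small: "card (\<Union>(f ` \<A>)) \<le> s" "card (\<Inter>(f ` \<A>)) < t"
    if f: "\<And>A. A \<in> \<A> \<Longrightarrow> f A = h A" for f
  proof -
    have eq: "f A - {i, j} = A - {i, j}" if "A \<in> \<A>" for A
      using f[OF that] by (auto simp: h_def swap_def)
    have "\<Inter>(f ` \<A>) = \<Inter>\<A>"
      by (rule Inter_image_eq[OF eq C'(1)]) (use C' f in \<open>auto simp: h_def\<close>)
    then show "card (\<Inter>(f ` \<A>)) < t" using struct(5) by simp
    obtain A where "A \<in> \<A>" "i \<in> A" using struct(2) by blast
    then have ij: "i \<noteq> j" using struct(1) by blast
    have "i \<notin> f A" if "A \<in> \<A>" for A using f[OF that] ij by (auto simp: h_def swap_def)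
    then have "\<Union>(f ` \<A>) \<subseteq> \<Union>\<A> - {i}"
      using eq struct(3) by blast
    then show "card (\<Union>(f ` \<A>)) \<le> s"
      using struct(4) card_mono[OF finite_Diff[OF finU]] by (meson le_trans)
  qed

  \<comment> \<open>No member of \<open>\<A>\<close> contains both \<open>i\<close> and
    \<open>j\<close>, and each one containing \<open>j\<close> is moved, so both parts are plain
    traces.\<close>
  have only: "only_part i j \<A> = {A \<in> \<A>. i \<in> A}"
    and moved: "moved_part \<F> i j \<A> = {A \<in> \<A>. j \<in> A}"
    using struct(1) by (auto simp: only_part_def moved_part_def)
  have \<G>: "\<G> = {A \<in> \<A>. i \<in> A \<and> swap A \<in> \<F>}"
    unfolding assms(7) only using struct(1) by (auto simp: shift_def swap_def)
  have swap_back: "swap A - {j} \<union> {i} = A" if "A \<in> \<A>" "i \<in> A" for A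
    using that struct(1) by (auto simp: swap_def)
  have \<G>': "\<G>' = swap ` \<G>" using assms(8) by (auto simp: swap_def)
  have \<B>: "\<B> = g ` \<A>"
  proof -
    have "g ` \<A> = (\<A> - \<G>) \<union> swap ` \<G>" by (auto simp: g_def \<G>)
    moreover have "moved_part \<F> i j \<A> \<union> neither_part i j \<A> \<union> (only_part i j \<A> - \<G>) = \<A> - \<G>"
      unfolding moved only neither_part_def using struct(1) by (auto simp: \<G>)
    ultimately show ?thesis by (simp add: assms(9) \<G>')
  qed
  have \<B>_sub: "\<B> \<subseteq> \<F>" using sub by (auto simp: \<B> g_def \<G>)
  have "A = B" if "A \<in> \<A>" "B \<in> \<A>" "g A = g B" for A B
  proof -
    \<comment> \<open>Were \<open>swap A\<close> a member of \<open>\<A>\<close>, it would be moved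
      by the \<open>(i, j)\<close> shift, yet swapping back gives \<open>A\<close>, which lies in
      \<open>\<F>\<close>.\<close>
    have neq: "swap A \<noteq> B" if "A \<in> \<G>" "B \<in> \<A>" for A B
    proof
      assume eq: "swap A = B"
      then have "j \<in> B" by (auto simp: swap_def)
      then have "swap A - {j} \<union> {i} \<notin> \<F>" using struct(1)[OF that(2)] eq by simp
      then show False using swap_back[of A] that(1) sub(1) by (auto simp: \<G>)
    qed
    show ?thesis
    proof (cases "A \<in> \<G> \<and> B \<in> \<G>")
      case True
      then have "swap A = swap B" using that by (simp add: g_def)
      then show ?thesis using True swap_back[of A] swap_back[of B] by (auto simp: \<G>)
    next
      case False
      then show ?thesis using that neq[of A B] neq[of B A] by (auto simp: g_def split: if_splits)
    qed
  qed
  then have card: "card \<B> = d" using sub by (simp add: \<B> card_image inj_on_def)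
  have fin: "finite \<B>" using sub by (simp add: \<B>)

  have neq: "\<G> \<noteq> only_part i j \<A>"
  proof
    assume "\<G> = only_part i j \<A>"
    then have "card (\<Union>\<B>) \<le> s" "card (\<Inter>\<B>) < t"
      unfolding \<B> using small[of g] by (auto simp: only g_def h_def)
    then show False
      using assms(2) \<B>_sub fin card unfolding cond_intersecting_def by (metis not_le)
  qed

  \<comment> \<open>The members containing \<open>i\<close> that \<open>g\<close> leaves alone have
    their swap outside \<open>\<F>\<close>, which is exactly when the \<open>(j, i)\<close> shift
    moves them.\<close>
  have "shift \<F> j i (g A) = h A" if "A \<in> \<A>" for A
    using that struct(1)[of A]
    by (auto simp: shift_def g_def h_def \<G> swap_def)
  then have "unstable d s t \<F> j i \<B>"
    unfolding unstable_iff using \<B>_sub fin card small[of "shift \<F> j i \<circ> g"]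
    by (simp add: \<B> image_comp)

  moreover have "\<A> = moved_part \<F> j i \<B> \<union> neither_part i j \<B> \<union> (only_part j i \<B> - \<H>) \<union> \<H>'"
  proof -
    obtain A where "A \<in> \<A>" "i \<in> A" using struct(2) by blast
    then have ij: "i \<noteq> j" using struct(1) by blast
    have "moved_part \<F> j i \<B> = {A \<in> \<A>. i \<in> A} - \<G>"
      unfolding \<B> using struct(1) ij by (auto simp: moved_part_def g_def \<G> swap_def)
    moreover have "neither_part i j \<B> = neither_part i j \<A>"
      unfolding \<B> using ij by (auto simp: neither_part_def g_def \<G> swap_def)
    moreover have only_\<B>: "only_part j i \<B> = {A \<in> \<A>. j \<in> A} \<union> swap ` \<G>"
      unfolding \<B> using struct(1) ij by (auto simp: only_part_def g_def \<G> swap_def)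
    moreover have \<H>: "\<H> = swap ` \<G>"
    proof -
      \<comment> \<open>Old members containing \<open>j\<close> move, while a swapped one is blocked
        by its preimage in \<open>\<F>\<close>; this separates \<open>\<H>\<close> from the
        rest.\<close>
      have "shift \<F> i j A \<noteq> A" if "A \<in> \<A>" "j \<in> A" for A
        using that struct(1)[OF that] by (auto simp: shift_def)
      moreover have "shift \<F> i j (swap A) = swap A" if "A \<in> \<G>" for A
        using that swap_back[of A] sub(1) by (auto simp: \<G> shift_def)
      ultimately show ?thesis unfolding assms(10) only_\<B> by auto
    qed
    moreover have "\<H>' = \<G>"
    proof -
      have "\<H>' = (\<lambda>A. swap A - {j} \<union> {i}) ` \<G>" unfolding assms(11) \<H> by auto
      also have "\<dots> = id ` \<G>" by (rule image_cong) (use swap_back \<G> in auto)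
      finally show ?thesis by simp
    qed
    moreover have "{A \<in> \<A>. j \<in> A} \<inter> swap ` \<G> = {}"
      using struct(1) swap_back sub(1) by (fastforce simp: \<G>)
    then have "{A \<in> \<A>. j \<in> A} \<union> swap ` \<G> - swap ` \<G> = {A \<in> \<A>. j \<in> A}" by blast
    moreover have "\<A> = {A \<in> \<A>. i \<in> A} - \<G> \<union> neither_part i j \<A> \<union> {A \<in> \<A>. j \<in> A} \<union> \<G>"
      by (auto simp: neither_part_def \<G>)
    ultimately show ?thesis by simp
  qed
  ultimately show ?thesis using neq \<B>_sub card by blast
qed

end
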